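(* Let $G$ be a finite permutation group acting transitively on a finite set $\Omega$, with $n=|\Omega|$, and let $\mathcal{K}(G)$ be its orbital coherent configuration with adjacency matrices $A_0=I,A_1,\dots,A_d$. For $u\in\mathbb{C}\Omega$ put \[D(u)=\sum_{i=0}^d \frac{1}{k_i}\,(uA_i^{\top}u^* )\,A_i,\qquad k_i=\operatorname{tr}(A_iA_i^{\top}).\] Let $u,v\in\mathbb{C}\Omega$. Then $u(v^g)^*$ takes the same value for all $g\in G$ if and only if \[vD(u)v^*=\frac{1}{n^2}(uJu^* )(vJv^* ),\] where $J$ is the $n\times n$ all-ones matrix.
   Context: Vectors in $\mathbb{C}\Omega$ are row vectors of length $n$ indexed by a fixed ordering of $\Omega$; $u^*$ denotes the conjugate transpose. For $g\in G$, $v^g$ denotes the vector obtained from $v$ by permuting coordinates according to $g$. The orbitals of $G$ are the orbits of $G$ on $\Omega\times\Omega$; they form a homogeneous coherent configuration $\mathcal{K}(G)=\{R_0,\dots,R_d\}$ with $R_0$ the diagonal orbital, and $A_i$ is the $0/1$ adjacency matrix of $R_i$. *)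

theory Defs
  imports "HOL-Analysis.Analysis" "HOL-Algebra.Group_Action"
begin

text \<open>
  The set \<open>\<Omega>\<close> is the universe of a finite type \<open>'n\<close>, and a permutation group on it is a
  subgroup of \<^term>\<open>BijGroup UNIV\<close>. Vectors \<open>complex ^ 'n\<close> are read as row vectors.
\<close>

definition orbitals :: "('n \<Rightarrow> 'n) set \<Rightarrow> ('n \<times> 'n) set set" where
  "orbitals G = orbits (BijGroup UNIV\<lparr>carrier := G\<rparr>) UNIV (\<lambda>g. map_prod g g)"

definition adj_matrix :: "('n \<times> 'n) set \<Rightarrow> complex ^ 'n ^ 'n" where
  "adj_matrix R = (\<chi> a b. if (a, b) \<in> R then 1 else 0)"

definition all_ones :: "complex ^ 'n ^ 'n" where
  "all_ones = (\<chi> a b. 1)"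

text \<open>The \<open>1 \<times> 1\<close> matrix \<open>x y\<^sup>*\<close>. (The class \<open>real_inner\<close> provides only its real part.)\<close>

definition row_prod :: "complex ^ 'n \<Rightarrow> complex ^ 'n \<Rightarrow> complex" where
  "row_prod x y = (\<Sum>a\<in>UNIV. x $ a * cnj (y $ a))"

text \<open>The Hermitian form value \<open>x M x\<^sup>*\<close>.\<close>

definition herm_form :: "complex ^ 'n ^ 'n \<Rightarrow> complex ^ 'n \<Rightarrow> complex" where
  "herm_form M x = row_prod (x v* M) x"

text \<open>
  The vector \<open>v\<^sup>g\<close>: the coordinate of \<open>v\<close> at the point \<open>a\<close> is moved to the point \<open>g a\<close>.
\<close>

definition perm_vec :: "('n \<Rightarrow> 'n) \<Rightarrow> complex ^ 'n \<Rightarrow> complex ^ 'n" where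
  "perm_vec g v = (\<chi> b. v $ inv_into UNIV g b)"

text \<open>
  \<open>R 0, \<dots>, R d\<close> is meant to enumerate the orbitals; the fraction is \<open>(u A\<^sub>i\<^sup>T u\<^sup>*) / k\<^sub>i\<close>.
\<close>

definition D_matrix :: "nat \<Rightarrow> (nat \<Rightarrow> ('n \<times> 'n) set) \<Rightarrow> complex ^ 'n \<Rightarrow> complex ^ 'n ^ 'n" where
  "D_matrix d R u =
     (\<chi> a b. \<Sum>i = 0..d.
        herm_form (transpose (adj_matrix (R i))) u
          / trace (adj_matrix (R i) ** transpose (adj_matrix (R i)))
          * adj_matrix (R i) $ a $ b)"

text \<open>
  The diagonal is an orbital of a transitive group, so the orbitals can always be listed
  with \<open>R 0\<close> the diagonal.
\<close>

lemma orbitals_enumeration_exists: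
  fixes G :: "('n::finite \<Rightarrow> 'n) set"
  assumes "transitive_action (BijGroup UNIV\<lparr>carrier := G\<rparr>) UNIV (\<lambda>g. g)"
  obtains d R where "bij_betw R {0..d::nat} (orbitals G)" and "R 0 = Id"
proof -
  interpret transitive_action "BijGroup UNIV\<lparr>carrier := G\<rparr>" UNIV "\<lambda>g. g"
    by (rule assms)
  have trans: "\<exists>g\<in>G. y = g x" for x y
    using unique_orbit[of x y] by auto
  have "orbit (BijGroup UNIV\<lparr>carrier := G\<rparr>) (\<lambda>g. map_prod g g) (x, x) = Id" for x
  proof (intro equalityI subsetI)
    fix p
    assume "p \<in> orbit (BijGroup UNIV\<lparr>carrier := G\<rparr>) (\<lambda>g. map_prod g g) (x, x)"
    then obtain g where "p = map_prod g g (x, x)"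
      unfolding orbit_def by blast
    then show "p \<in> Id"
      by simp
  next
    fix p :: "'n \<times> 'n"
    assume "p \<in> Id"
    moreover obtain g where g: "g \<in> G" "fst p = g x"
      using trans by blast
    ultimately have "p = map_prod g g (x, x)"
      by (metis IdE fst_conv map_prod_simp)
    then show "p \<in> orbit (BijGroup UNIV\<lparr>carrier := G\<rparr>) (\<lambda>g. map_prod g g) (x, x)"
      unfolding orbit_def using g(1) by auto
  qed
  then have Id: "Id \<in> orbitals G"
    unfolding orbitals_def orbits_def by blast
  obtain h where h: "bij_betw h {0..<card (orbitals G - {Id})} (orbitals G - {Id})"
    using ex_bij_betw_nat_finite[of "orbitals G - {Id}"] by auto
  define d where "d = card (orbitals G - {Id})"
  define R where "R = (\<lambda>i. case i of 0 \<Rightarrow> Id | Suc j \<Rightarrow> h j)"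
  have dec: "{0..d} = insert 0 (Suc ` {0..<d})"
    by (simp add: atLeastLessThanSuc_atLeastAtMost Icc_eq_insert_lb_nat)
  have "inj_on R (Suc ` {0..<d})"
    using bij_betw_imp_inj_on[OF h] unfolding inj_on_def R_def d_def
    by (simp del: image_Suc_atLeastLessThan)
  moreover have "R ` Suc ` {0..<d} = orbitals G - {Id}"
    using bij_betw_imp_surj_on[OF h] unfolding image_image R_def d_def by simp
  moreover have "R 0 = Id"
    by (simp add: R_def)
  ultimately have "bij_betw R {0..d} (orbitals G)"
    unfolding bij_betw_def dec inj_on_insert image_insert using insert_Diff[OF Id] by auto
  then show thesis
    by (rule that) (simp add: R_def)
qed

end

theory Submission
  imports Defs
begin

text \<open>
  Write \<open>f g = u (v\<^sup>g)\<^sup>*\<close>. Averaging over \<open>G\<close> turns a point into the uniform distribution on its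
  orbit. Applied to pairs of points this shows that \<open>v D(u) v\<^sup>*\<close> is the mean of \<open>\<bar>f\<bar>\<^sup>2\<close>; applied to
  points, transitivity shows that \<open>(u J u\<^sup>*) (v J v\<^sup>*) / n\<^sup>2\<close> is the squared modulus of the mean of
  \<open>f\<close>. The two agree iff the variance of \<open>f\<close> vanishes, that is, iff \<open>f\<close> is constant.
\<close>

lemma (in group_action) bij_betw_orbit:
  assumes "g \<in> carrier G" "x \<in> E"
  shows "bij_betw (\<phi> g) (orbit G \<phi> x) (orbit G \<phi> x)"
proof -
  interpret group G
    using group_hom by (rule group_hom.axioms(1))
  have sub: "orbit G \<phi> x \<subseteq> E"
    using element_image assms(2) by (auto simp: orbit_def)
  have closed: "\<phi> h y \<in> orbit G \<phi> x" if h: "h \<in> carrier G" and y: "y \<in> orbit G \<phi> x" for h y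
  proof -
    obtain k where "k \<in> carrier G" "y = \<phi> k x"
      using y by (auto simp: orbit_def)
    with h assms(2) show ?thesis
      by (auto simp: orbit_def intro!: exI[of _ "h \<otimes> k"] composition_rule[symmetric])
  qed
  have left: "\<phi> (inv g) (\<phi> g y) = y" if "y \<in> E" for y
    using orbit_sym_aux[OF assms(1) that] by simp
  have right: "\<phi> g (\<phi> (inv g) y) = y" if "y \<in> E" for y
    using orbit_sym_aux[of "inv g" y] that assms(1) by simp
  show ?thesis
    by (rule bij_betw_byWitness[where f' = "\<phi> (inv g)"])
      (use sub closed left right assms(1) in auto)
qed

text \<open>Sum \<open>f (\<phi> g y)\<close> over all \<open>g\<close> in the group and
  \<open>y\<close> in the orbit of \<open>x\<close>. For fixed \<open>y = \<phi> h x\<close>, right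
  translation by \<open>h\<close> shows that the sum over \<open>g\<close> does not depend on
  \<open>y\<close>; for fixed \<open>g\<close>, the map \<open>\<phi> g\<close> permutes the orbit.
  The two orders of summation give the two sides.\<close>

lemma (in group_action) sum_orbit_average:
  fixes f :: "'c \<Rightarrow> 'd::comm_semiring_1"
  assumes "x \<in> E"
  shows "of_nat (card (orbit G \<phi> x)) * (\<Sum>g\<in>carrier G. f (\<phi> g x)) =
    of_nat (card (carrier G)) * (\<Sum>y\<in>orbit G \<phi> x. f y)"
proof -
  interpret group G
    using group_hom by (rule group_hom.axioms(1))
  have const: "(\<Sum>g\<in>carrier G. f (\<phi> g y)) = (\<Sum>g\<in>carrier G. f (\<phi> g x))"
    if y: "y \<in> orbit G \<phi> x" for y
  proof -
    obtain h where h: "h \<in> carrier G" "y = \<phi> h x"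
      using y by (auto simp: orbit_def)
    have "bij_betw (\<lambda>g. g \<otimes> h) (carrier G) (carrier G)"
      by (rule bij_betw_byWitness[where f' = "\<lambda>g. g \<otimes> inv h"])
        (use h in \<open>auto simp: m_assoc\<close>)
    then have "(\<Sum>g\<in>carrier G. f (\<phi> g x)) = (\<Sum>g\<in>carrier G. f (\<phi> (g \<otimes> h) x))"
      by (rule sum.reindex_bij_betw[symmetric])
    also have "\<dots> = (\<Sum>g\<in>carrier G. f (\<phi> g y))"
      using h assms by (intro sum.cong) (simp_all add: composition_rule)
    finally show ?thesis
      by simp
  qed
  have "of_nat (card (orbit G \<phi> x)) * (\<Sum>g\<in>carrier G. f (\<phi> g x)) =
      (\<Sum>y\<in>orbit G \<phi> x. \<Sum>g\<in>carrier G. f (\<phi> g y))"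
    by (simp add: const)
  also have "\<dots> = (\<Sum>g\<in>carrier G. \<Sum>y\<in>orbit G \<phi> x. f (\<phi> g y))"
    by (rule sum.swap)
  also have "\<dots> = (\<Sum>g\<in>carrier G. \<Sum>y\<in>orbit G \<phi> x. f y)"
    by (intro sum.cong refl sum.reindex_bij_betw bij_betw_orbit assms)
  finally show ?thesis
    by simp
qed

text \<open>Equality case of Cauchy-Schwarz for \<open>f\<close> against the constant function 1.
  With \<open>m\<close> the mean of \<open>f\<close>, the difference of the two sides is
  \<open>card S\<close> times the sum of the squared moduli of \<open>f x - m\<close>.\<close>

lemma constant_iff_sum_norm_square:
  fixes f :: "'a \<Rightarrow> complex"
  assumes "finite S" "S \<noteq> {}"
  shows "(\<exists>c. \<forall>x\<in>S. f x = c) \<longleftrightarrow>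
    of_nat (card S) * (\<Sum>x\<in>S. f x * cnj (f x)) = sum f S * cnj (sum f S)"
proof
  assume "\<exists>c. \<forall>x\<in>S. f x = c"
  then show "of_nat (card S) * (\<Sum>x\<in>S. f x * cnj (f x)) = sum f S * cnj (sum f S)"
    by auto
next
  assume eq: "of_nat (card S) * (\<Sum>x\<in>S. f x * cnj (f x)) = sum f S * cnj (sum f S)"
  define N where "N = (of_nat (card S) :: complex)"
  define m where "m = sum f S / N"
  have N: "N \<noteq> 0" "cnj N = N"
    using assms by (auto simp: N_def)
  have sm: "sum f S = N * m"
    using N by (simp add: m_def)
  have "N * (\<Sum>x\<in>S. f x * cnj (f x)) = N * (N * m * cnj m)"
    using eq by (simp add: sm N flip: N_def)
  then have sq: "(\<Sum>x\<in>S. f x * cnj (f x)) = N * m * cnj m"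
    using N by simp
  have "(\<Sum>x\<in>S. (f x - m) * cnj (f x - m)) =
      (\<Sum>x\<in>S. f x * cnj (f x)) - sum f S * cnj m - m * cnj (sum f S) + N * m * cnj m"
    by (simp add: algebra_simps sum.distrib sum_subtractf N_def
        flip: sum_distrib_left sum_distrib_right)
  also have "\<dots> = 0"
    by (simp add: sq sm N)
  \<comment> \<open>Passing to the reals makes nonnegativity available, so that every term of the
    vanishing sum is zero.\<close>
  finally have "complex_of_real (\<Sum>x\<in>S. (cmod (f x - m))\<^sup>2) = 0"
    by (simp only: of_real_sum complex_norm_square)
  then have "(\<Sum>x\<in>S. (cmod (f x - m))\<^sup>2) = 0"
    by (simp only: of_real_eq_0_iff)
  then have "\<forall>x\<in>S. f x = m"
    using assms(1) by (simp add: sum_nonneg_eq_0_iff)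
  then show "\<exists>c. \<forall>x\<in>S. f x = c"
    by blast
qed

lemma herm_form_eq_sum:
  "herm_form M x = (\<Sum>a\<in>UNIV. \<Sum>b\<in>UNIV. x $ a * M $ a $ b * cnj (x $ b))"
  unfolding herm_form_def row_prod_def vector_matrix_mult_def
  by (subst sum.swap) (simp add: sum_distrib_left sum_distrib_right mult_ac)

lemma herm_form_all_ones: "herm_form all_ones x = (\<Sum>a\<in>UNIV. x $ a) * cnj (\<Sum>a\<in>UNIV. x $ a)"
  by (simp add: herm_form_eq_sum all_ones_def sum_product)

lemma sum_indicator_pairs:
  fixes f :: "'n::finite \<Rightarrow> 'n \<Rightarrow> 'a::comm_monoid_add"
  shows "(\<Sum>x\<in>UNIV. \<Sum>y\<in>UNIV. if (x, y) \<in> S then f x y else 0) = (\<Sum>(x, y)\<in>S. f x y)"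
proof -
  have "(\<Sum>x\<in>UNIV. \<Sum>y\<in>UNIV. if (x, y) \<in> S then f x y else 0) =
      (\<Sum>p\<in>UNIV. if p \<in> S then case_prod f p else 0)"
    unfolding UNIV_Times_UNIV[symmetric]
    by (subst sum.cartesian_product) (auto intro!: sum.cong)
  also have "\<dots> = (\<Sum>(x, y)\<in>S. f x y)"
    by (simp flip: sum.inter_restrict)
  finally show ?thesis .
qed

text \<open>The transpose puts the unconjugated factor at the second coordinate of each pair.
  Without it, the form of \<open>D_matrix\<close> at \<open>v\<close> would average the squared
  modulus of the sum of \<open>u $ g a * v $ a\<close>, with \<open>v\<close> unconjugated.\<close>

lemma herm_form_transpose_adj_matrix:
  "herm_form (transpose (adj_matrix S)) u = (\<Sum>(x, y)\<in>S. u $ y * cnj (u $ x))"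
  unfolding herm_form_eq_sum
  by (subst sum.swap)
    (simp add: transpose_def adj_matrix_def if_distrib if_distribR
      flip: sum_indicator_pairs cong: if_cong)

text \<open>The diagonal entry at \<open>x\<close> counts the pairs in \<open>S\<close> with first
  coordinate \<open>x\<close>. Hence dividing by the trace in \<open>D_matrix\<close> turns a sum
  over an orbital into a uniform average.\<close>

lemma trace_adj_matrix: "trace (adj_matrix S ** transpose (adj_matrix S)) = of_nat (card S)"
proof -
  have "trace (adj_matrix S ** transpose (adj_matrix S)) =
      (\<Sum>x\<in>UNIV. \<Sum>y\<in>UNIV. if (x, y) \<in> S then 1 else 0)"
    by (auto simp: trace_def matrix_matrix_mult_def transpose_def adj_matrix_def intro!: sum.cong)
  then show ?thesis
    by (simp add: sum_indicator_pairs case_prod_unfold)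
qed

text \<open>The substitution \<open>b = g a\<close> moves the permutation from \<open>v\<close> to
  \<open>u\<close>, so that only values of \<open>u\<close> vary with \<open>g\<close> and the
  inverse disappears.\<close>

lemma row_prod_perm_vec:
  assumes "bij g"
  shows "row_prod u (perm_vec g v) = (\<Sum>a\<in>UNIV. u $ g a * cnj (v $ a))"
  using sum.reindex_bij_betw[OF assms, of "\<lambda>b. u $ b * cnj (perm_vec g v $ b)"]
  by (simp add: row_prod_def perm_vec_def bij_is_inj[OF assms])

text \<open>The orbitals are the orbits of this diagonal action, so orbit averaging applies to
  them.\<close>

lemma group_action_pairs:
  assumes "group_action (BijGroup UNIV\<lparr>carrier := G\<rparr>) UNIV (\<lambda>g. g)"
  shows "group_action (BijGroup UNIV\<lparr>carrier := G\<rparr>) UNIV (\<lambda>g. map_prod g g)"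
proof -
  interpret group_action "BijGroup UNIV\<lparr>carrier := G\<rparr>" UNIV "\<lambda>g. g"
    by (rule assms)
  have Bij: "g \<in> Bij UNIV" if "g \<in> G" for g
    using bij_prop0[of g] that by simp
  have Bij_pairs: "map_prod g g \<in> Bij UNIV" if "g \<in> G" for g
    using bij_betw_map_prod[of g UNIV UNIV g UNIV UNIV] Bij[OF that] by (simp add: Bij_def)
  have "(\<lambda>g. map_prod g g) \<in> hom (BijGroup UNIV\<lparr>carrier := G\<rparr>) (BijGroup UNIV)"
    by (rule homI) (auto simp: BijGroup_def Bij Bij_pairs compose_def fun_eq_iff)
  then show ?thesis
    by (intro group_action.intro group_hom.intro group_hom_axioms.intro group_BijGroup
        group_hom.axioms(1)[OF group_hom])
qed

text \<open>Orbitals are disjoint, so only the one containing \<open>(a, b)\<close> contributes. Its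
  coefficient is the average of \<open>u $ y * cnj (u $ x)\<close> over that orbital, which orbit
  averaging turns into a mean over \<open>G\<close>.\<close>

lemma D_matrix_entry:
  assumes "group_action (BijGroup UNIV\<lparr>carrier := G\<rparr>) UNIV (\<lambda>g. g)"
    and "bij_betw R {0..d} (orbitals G)"
  shows "of_nat (card G) * D_matrix d R u $ a $ b = (\<Sum>g\<in>G. u $ g b * cnj (u $ g a))"
proof -
  let ?G = "BijGroup UNIV\<lparr>carrier := G\<rparr>"
  interpret P: group_action ?G UNIV "\<lambda>g. map_prod g g"
    by (rule group_action_pairs[OF assms(1)])
  define O1 where "O1 = orbit ?G (\<lambda>g. map_prod g g) (a, b)"
  define h where "h S = (\<Sum>(x, y)\<in>S. u $ y * cnj (u $ x)) / of_nat (card S)" for S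
  have mem: "(a, b) \<in> O1"
    unfolding O1_def by (rule P.orbit_refl) simp
  have orb: "O1 \<in> orbitals G"
    unfolding O1_def orbitals_def orbits_def by blast
  have uniq: "(a, b) \<in> S \<longleftrightarrow> S = O1" if "S \<in> orbitals G" for S
    using P.disjoint_union[of S O1] that mem orb by (auto simp: orbitals_def)
  have adj: "adj_matrix S $ a $ b = (if (a, b) \<in> S then 1 else 0)" for S
    by (simp add: adj_matrix_def)
  have "D_matrix d R u $ a $ b = (\<Sum>i = 0..d. if (a, b) \<in> R i then h (R i) else 0)"
    by (auto simp: D_matrix_def herm_form_transpose_adj_matrix trace_adj_matrix h_def adj
        intro!: sum.cong)
  also have "\<dots> = (\<Sum>S\<in>orbitals G. if (a, b) \<in> S then h S else 0)"
    by (rule sum.reindex_bij_betw[OF assms(2)])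
  also have "\<dots> = (\<Sum>S\<in>orbitals G. if S = O1 then h S else 0)"
    by (intro sum.cong) (simp_all add: uniq)
  also have "\<dots> = h O1"
    using orb by simp
  finally have D: "D_matrix d R u $ a $ b = h O1" .
  have "card O1 \<noteq> 0"
    using mem by auto
  moreover have "of_nat (card O1) * (\<Sum>g\<in>G. u $ g b * cnj (u $ g a)) =
      of_nat (card G) * (\<Sum>(x, y)\<in>O1. u $ y * cnj (u $ x))"
    using P.sum_orbit_average[of "(a, b)" "\<lambda>(x, y). u $ y * cnj (u $ x)"]
    by (simp add: O1_def)
  ultimately show ?thesis
    by (simp add: D h_def field_simps)
qed

lemma herm_form_D_matrix:
  fixes G :: "('n::finite \<Rightarrow> 'n) set" and u v :: "complex ^ 'n"
  assumes "group_action (BijGroup UNIV\<lparr>carrier := G\<rparr>) UNIV (\<lambda>g. g)"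
    and "bij_betw R {0..d} (orbitals G)"
  defines "f \<equiv> \<lambda>g. \<Sum>a\<in>UNIV. u $ g a * cnj (v $ a)"
  shows "of_nat (card G) * herm_form (D_matrix d R u) v = (\<Sum>g\<in>G. f g * cnj (f g))"
proof -
  have "of_nat (card G) * herm_form (D_matrix d R u) v =
      (\<Sum>a\<in>UNIV. \<Sum>b\<in>UNIV. v $ a * (of_nat (card G) * D_matrix d R u $ a $ b) * cnj (v $ b))"
    by (simp add: herm_form_eq_sum sum_distrib_left mult_ac)
  also have "\<dots> = (\<Sum>a\<in>UNIV. \<Sum>b\<in>UNIV. \<Sum>g\<in>G.
      (u $ g b * cnj (v $ b)) * cnj (u $ g a * cnj (v $ a)))"
    unfolding D_matrix_entry[OF assms(1,2)]
    by (simp add: sum_distrib_left sum_distrib_right mult_ac)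
  also have "\<dots> = (\<Sum>a\<in>UNIV. \<Sum>g\<in>G. \<Sum>b\<in>UNIV.
      (u $ g b * cnj (v $ b)) * cnj (u $ g a * cnj (v $ a)))"
    by (intro sum.cong refl sum.swap)
  also have "\<dots> = (\<Sum>g\<in>G. \<Sum>a\<in>UNIV. \<Sum>b\<in>UNIV.
      (u $ g b * cnj (v $ b)) * cnj (u $ g a * cnj (v $ a)))"
    by (rule sum.swap)
  also have "\<dots> = (\<Sum>g\<in>G. f g * cnj (f g))"
    \<comment> \<open>The index \<open>b\<close> carries \<open>f g\<close> and \<open>a\<close> its
      conjugate; swapping them puts the factors in the order of the product.\<close>
    unfolding f_def cnj_sum by (subst sum.swap) (simp only: sum_product)
  finally show ?thesis .
qed

text \<open>The only orbit is the whole set, so for each \<open>a\<close> the mean of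
  \<open>u $ g a\<close> over \<open>G\<close> is the mean of the coordinates of \<open>u\<close>.
  Since this is independent of \<open>a\<close>, the sum over \<open>a\<close> factors.\<close>

lemma sum_transitive:
  fixes G :: "('n::finite \<Rightarrow> 'n) set" and u v :: "complex ^ 'n"
  assumes "transitive_action (BijGroup UNIV\<lparr>carrier := G\<rparr>) UNIV (\<lambda>g. g)"
  shows "of_nat CARD('n) * (\<Sum>g\<in>G. \<Sum>a\<in>UNIV. u $ g a * cnj (v $ a)) =
    of_nat (card G) * (\<Sum>a\<in>UNIV. u $ a) * cnj (\<Sum>a\<in>UNIV. v $ a)"
proof -
  interpret transitive_action "BijGroup UNIV\<lparr>carrier := G\<rparr>" UNIV "\<lambda>g. g"
    by (rule assms)
  have orb: "orbit (BijGroup UNIV\<lparr>carrier := G\<rparr>) (\<lambda>g. g) x = UNIV" for x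
    using unique_orbit[of x] by (fastforce simp: orbit_def)
  have avg: "of_nat CARD('n) * (\<Sum>g\<in>G. u $ g a) = of_nat (card G) * (\<Sum>a\<in>UNIV. u $ a)" for a
    using sum_orbit_average[of a "\<lambda>x. u $ x"] by (simp add: orb)
  have "of_nat CARD('n) * (\<Sum>g\<in>G. \<Sum>a\<in>UNIV. u $ g a * cnj (v $ a)) =
      (\<Sum>a\<in>UNIV. (of_nat CARD('n) * (\<Sum>g\<in>G. u $ g a)) * cnj (v $ a))"
    by (subst sum.swap) (simp add: sum_distrib_left sum_distrib_right mult_ac)
  also have "\<dots> = of_nat (card G) * (\<Sum>a\<in>UNIV. u $ a) * cnj (\<Sum>a\<in>UNIV. v $ a)"
    by (simp only: avg cnj_sum sum_distrib_left[symmetric])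
  finally show ?thesis .
qed

theorem theorem4p2:
  fixes G :: "('n::finite \<Rightarrow> 'n) set"
    and d :: nat
    and R :: "nat \<Rightarrow> ('n \<times> 'n) set"
    and u v :: "complex ^ 'n"
  assumes "subgroup G (BijGroup UNIV)"
    and "transitive_action (BijGroup UNIV\<lparr>carrier := G\<rparr>) UNIV (\<lambda>g. g)"
    and "bij_betw R {0..d} (orbitals G)"
    and "R 0 = Id"
  shows "(\<exists>c. \<forall>g\<in>G. row_prod u (perm_vec g v) = c) \<longleftrightarrow>
         herm_form (D_matrix d R u) v =
           1 / (of_nat CARD('n))\<^sup>2 * (herm_form all_ones u * herm_form all_ones v)"
proof -
  define f where "f g = (\<Sum>a\<in>UNIV. u $ g a * cnj (v $ a))" for g :: "'n \<Rightarrow> 'n"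
  define N where "N = (of_nat (card G) :: complex)"
  define n where "n = (of_nat CARD('n) :: complex)"
  define s where "s = (\<Sum>a\<in>UNIV. u $ a) * cnj (\<Sum>a\<in>UNIV. v $ a)"
  have action: "group_action (BijGroup UNIV\<lparr>carrier := G\<rparr>) UNIV (\<lambda>g. g)"
    by (rule transitive_action.axioms(1)[OF assms(2)])
  have G: "finite G" "G \<noteq> {}"
    using subgroup.one_closed[OF assms(1)] by auto
  have bij: "bij g" if "g \<in> G" for g
    using subgroup.mem_carrier[OF assms(1) that] by (simp add: BijGroup_def Bij_def)
  have N: "N \<noteq> 0" and n: "n \<noteq> 0" "cnj n = n"
    using G by (auto simp: N_def n_def)
  have "n * sum f G = N * s"
    using sum_transitive[OF assms(2), of u v] by (simp add: f_def N_def n_def s_def mult.assoc)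
  then have mean: "sum f G = N * s / n"
    using n by (simp add: field_simps)
  have "(\<exists>c. \<forall>g\<in>G. row_prod u (perm_vec g v) = c) \<longleftrightarrow> (\<exists>c. \<forall>g\<in>G. f g = c)"
    by (simp add: f_def row_prod_perm_vec bij)
  also have "\<dots> \<longleftrightarrow> N * (\<Sum>g\<in>G. f g * cnj (f g)) = sum f G * cnj (sum f G)"
    unfolding N_def by (rule constant_iff_sum_norm_square[OF G])
  also have "(\<Sum>g\<in>G. f g * cnj (f g)) = N * herm_form (D_matrix d R u) v"
    using herm_form_D_matrix[OF action assms(3), of u v] by (simp add: f_def N_def)
  \<comment> \<open>Writing out two factors \<open>N\<close> matches the two on the other side;
    cancelling both leaves the claimed equation.\<close>
  also have "sum f G * cnj (sum f G) = N * (N * (s * cnj s / n\<^sup>2))"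
    using n by (simp add: mean power2_eq_square N_def)
  also have "s * cnj s / n\<^sup>2 = 1 / n\<^sup>2 * (herm_form all_ones u * herm_form all_ones v)"
    by (simp add: s_def herm_form_all_ones mult_ac)
  finally show ?thesis
    unfolding mult_left_cancel[OF N] n_def .
qed

end
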